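(* Let $X$ be a finite connected pure $2$-dimensional simplicial complex in which every edge ($1$-face) is contained in exactly $D$ two-dimensional faces, for some fixed positive integer $D$. Let $V$ be the vertex set of $X$, let $W$ be the set of edges of $X$ (the vertex set of the embedded graph of $X$), let $\delta_{min}=\min_{v\in V}\delta(v)$, where $\delta(v)$ is the number of edges of $X$ containing $v$, and let $\lambda$ be the second largest eigenvalue of the adjacency matrix of the embedded graph of $X$. Then \[\frac{|V|\cdot \delta_{min}\cdot(2D-\lambda)}{4\cdot |W|} \leq H(X).\]
   Context: A simplicial complex is pure if all its inclusion-maximal faces have the same dimension. For a finite connected pure $n$-dimensional simplicial complex $X$ with vertex set $V$, define \[H(X)=\min_{0<|A|<|V|} \frac{|V|\cdot|F(A,V\setminus A)|}{|A|\cdot|V\setminus A|},\] where $A$ ranges over nonempty proper subsets of $V$ and $F(A,V\setminus A)$ is the set of $n$-faces of $X$ that contain at least one vertex of $A$ and at least one vertex of $V\setminus A$. The embedded graph of $X$ is the graph whose vertices are the $(n-1)$-faces of $X$, two distinct $(n-1)$-faces being joined by an edge if and only if they are both contained in a common $n$-face of $X$. Here $n=2$. *)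

theory Defs
  imports
    Complex_Main
    "HOL-Library.Multiset"
    "HOL-Computational_Algebra.Polynomial"
    "Jordan_Normal_Form.Char_Poly"
begin

text \<open>Abstract simplicial complexes, given by their set of nonempty faces: the empty set is not
  counted as a face, so every face has a dimension in the natural numbers.\<close>

definition simplicial_complex :: "'a set set \<Rightarrow> bool" where
  "simplicial_complex X \<longleftrightarrow>
     (\<forall>F\<in>X. finite F \<and> F \<noteq> {}) \<and> (\<forall>F\<in>X. \<forall>G. G \<subseteq> F \<and> G \<noteq> {} \<longrightarrow> G \<in> X)"

definition verts :: "'a set set \<Rightarrow> 'a set" where
  "verts X = \<Union>X"

definition faces :: "nat \<Rightarrow> 'a set set \<Rightarrow> 'a set set" where
  "faces k X = {F \<in> X. card F = k + 1}"

definition pure_complex :: "nat \<Rightarrow> 'a set set \<Rightarrow> bool" where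
  "pure_complex n X \<longleftrightarrow>
     X \<noteq> {} \<and> (\<forall>F\<in>X. (\<forall>G\<in>X. F \<subseteq> G \<longrightarrow> G = F) \<longrightarrow> F \<in> faces n X)"

text \<open>Connectedness via edge paths. The pair is also related when \<open>u = v\<close>, which is harmless
  under the reflexive transitive closure.\<close>

definition connected_complex :: "'a set set \<Rightarrow> bool" where
  "connected_complex X \<longleftrightarrow>
     (\<forall>u\<in>verts X. \<forall>v\<in>verts X. (u, v) \<in> {(x, y). {x, y} \<in> X}\<^sup>*)"

definition cut_faces :: "nat \<Rightarrow> 'a set set \<Rightarrow> 'a set \<Rightarrow> 'a set \<Rightarrow> 'a set set" where
  "cut_faces n X A B = {F \<in> faces n X. F \<inter> A \<noteq> {} \<and> F \<inter> B \<noteq> {}}"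

text \<open>The quantity \<open>H(X)\<close> of an \<open>n\<close>-dimensional complex. The minimum is only meaningful for a
  finite vertex set with at least two elements.\<close>

definition cheeger :: "nat \<Rightarrow> 'a set set \<Rightarrow> real" where
  "cheeger n X = (let V = verts X in
     Min ((\<lambda>A. real (card V) * real (card (cut_faces n X A (V - A)))
                 / (real (card A) * real (card (V - A))))
          ` {A. A \<subseteq> V \<and> 0 < card A \<and> card A < card V}))"

definition vertex_degree :: "'a set set \<Rightarrow> 'a \<Rightarrow> nat" where
  "vertex_degree X v = card {e \<in> faces 1 X. v \<in> e}"

definition min_degree :: "'a set set \<Rightarrow> nat" where
  "min_degree X = Min (vertex_degree X ` verts X)"

text \<open>Adjacency in the embedded graph, whose vertex set is \<open>faces (n - 1) X\<close> (with \<open>n \<ge> 1\<close>).\<close>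

definition embedded_adj :: "nat \<Rightarrow> 'a set set \<Rightarrow> 'a set \<Rightarrow> 'a set \<Rightarrow> bool" where
  "embedded_adj n X e e' \<longleftrightarrow>
     e \<in> faces (n - 1) X \<and> e' \<in> faces (n - 1) X \<and> e \<noteq> e' \<and>
     (\<exists>F\<in>faces n X. e \<subseteq> F \<and> e' \<subseteq> F)"

text \<open>Matrices are indexed by natural numbers, so the adjacency matrix of a graph depends on an
  enumeration \<open>vs\<close> of its vertices; its characteristic polynomial does not.\<close>

definition adjacency_matrix :: "'v list \<Rightarrow> ('v \<Rightarrow> 'v \<Rightarrow> bool) \<Rightarrow> real mat" where
  "adjacency_matrix vs adj =
     mat (length vs) (length vs) (\<lambda>(i, j). if adj (vs ! i) (vs ! j) then 1 else 0)"

text \<open>Real eigenvalues in decreasing order, listed with their multiplicity as roots of the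
  characteristic polynomial; the second largest one may therefore coincide with the largest.\<close>

definition real_eigenvalues :: "real mat \<Rightarrow> real list" where
  "real_eigenvalues A = rev (sorted_list_of_multiset (proots (char_poly A)))"

definition second_largest_eigenvalue :: "real mat \<Rightarrow> real" where
  "second_largest_eigenvalue A = real_eigenvalues A ! 1"

end

(* The embedded graph is 2D-regular, since two distinct edges lie in at most one common triangle.
   Given a vertex set A, test the spectral gap 2D - lambda with f(e) = |e \<inter> A|, centred at its mean.
   Every cut triangle contributes 2 to the Dirichlet energy of f, so the energy is 2|F|, and the
   variance is S_A S_B / |W| - E_AB, where B is the complement of A, S_P is the degree sum over P and
   E_AB counts the cut edges. A cut triangle has exactly two cut edges, hence D E_AB = 2|F|.
   Together with lambda \<ge> -1, S_P \<ge> delta_min |P| and delta_min \<ge> 2 this gives the bound.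

   For the spectral gap, the Rayleigh quotient on the mean-zero unit sphere is maximised at an
   eigenvector orthogonal to the constants. Its eigenvalue mu and the degree d are both roots of the
   characteristic polynomial; if mu = d, the root is double because every principal minor of size
   n - 1 inherits an eigenvector vanishing at the deleted index. *)

theory Submission
  imports Defs "HOL-Analysis.Function_Topology"
begin

section \<open>Rayleigh quotients and the second largest eigenvalue\<close>

text \<open>First-order condition at a minimum: near 0 the linear term dominates the quadratic one
  and would make the polynomial negative on one side.\<close>

lemma linear_coeff_zero:
  fixes b c :: real
  assumes "\<And>t. 0 \<le> 2 * t * b + t\<^sup>2 * c"
  shows "b = 0"
proof (rule ccontr)
  assume b: "b \<noteq> 0"
  \<comment> \<open>A positive upper bound for \<open>c\<close>, whatever its sign. With
    \<open>c\<close> replaced by \<open>s\<close>, the polynomial at \<open>t = - b / s\<close> is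
    \<open>- b^2 / s\<close>, already negative.\<close>
  define s where "s = \<bar>c\<bar> + 1"
  have s: "s > 0" "c \<le> s" by (auto simp: s_def)
  have "0 \<le> 2 * (- b / s) * b + (- b / s)\<^sup>2 * c" using assms .
  also have "\<dots> \<le> 2 * (- b / s) * b + (- b / s)\<^sup>2 * s"
    using s by (intro add_left_mono mult_left_mono) auto
  also have "\<dots> = - (b\<^sup>2 / s)" using s by (simp add: field_simps power2_eq_square)
  also have "\<dots> < 0" using b s by simp
  finally show False by simp
qed

text \<open>Pinning the coordinates outside \<open>I\<close> to 0 puts the sphere inside a product
  of compact sets, so Tychonoff applies even when the index type is infinite. The remaining
  conditions are closed because each involves only finitely many coordinates.\<close>

lemma compact_unit_sphere_fun:
  assumes "finite I"
  shows "compact {f :: 'v \<Rightarrow> real. (\<forall>i. i \<notin> I \<longrightarrow> f i = 0) \<and> (\<Sum>i\<in>I. (f i)\<^sup>2) = 1 \<and> sum f I = 0}"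
    (is "compact ?S")
proof -
  let ?K = "PiE UNIV (\<lambda>i. if i \<in> I then {-1..1::real} else {0})"
  have "compactin (product_topology (\<lambda>i. euclidean) UNIV) ?K"
    by (subst compactin_PiE) auto
  then have K: "compact ?K" by (simp add: euclidean_product_topology)
  have "closed {f :: 'v \<Rightarrow> real. (\<Sum>i\<in>I. (f i)\<^sup>2) = 1}"
    by (intro closed_Collect_eq continuous_intros continuous_on_product_coordinates)
  moreover have "closed {f :: 'v \<Rightarrow> real. sum f I = 0}"
    by (intro closed_Collect_eq continuous_intros continuous_on_product_coordinates)
  ultimately have "compact (?K \<inter> {f. (\<Sum>i\<in>I. (f i)\<^sup>2) = 1} \<inter> {f. sum f I = 0})"
    by (intro compact_Int_closed K)
  also have "?K \<inter> {f. (\<Sum>i\<in>I. (f i)\<^sup>2) = 1} \<inter> {f. sum f I = 0} = ?S"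
  proof (intro equalityI subsetI)
    fix f assume f: "f \<in> ?S"
    have "\<bar>f i\<bar> \<le> 1" if "i \<in> I" for i
    proof -
      have "(f i)\<^sup>2 \<le> (\<Sum>i\<in>I. (f i)\<^sup>2)" using assms that by (intro member_le_sum) auto
      then show ?thesis using f by (simp add: abs_square_le_1)
    qed
    then show "f \<in> ?K \<inter> {f. (\<Sum>i\<in>I. (f i)\<^sup>2) = 1} \<inter> {f. sum f I = 0}"
      using f by (auto simp: PiE_iff abs_le_iff minus_le_iff)
  qed (auto simp: PiE_iff split: if_splits)
  finally show ?thesis .
qed

text \<open>A maximiser on the mean-zero unit sphere satisfies a Lagrange condition. Constant row
  sums make the mean-zero functions an invariant subspace, so the multiplier for the constraint
  \<open>sum g I = 0\<close> vanishes and a genuine eigenvector results.\<close>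

lemma rayleigh_quotient_attained:
  fixes a :: "'v \<Rightarrow> 'v \<Rightarrow> real"
  assumes fin: "finite I" and card: "card I \<ge> 2"
    and sym: "\<And>i j. i \<in> I \<Longrightarrow> j \<in> I \<Longrightarrow> a i j = a j i"
    and row: "\<And>i. i \<in> I \<Longrightarrow> (\<Sum>j\<in>I. a i j) = d"
  obtains g \<mu> where "\<exists>i\<in>I. g i \<noteq> 0" and "sum g I = 0"
    and "\<And>i. i \<in> I \<Longrightarrow> (\<Sum>j\<in>I. a i j * g j) = \<mu> * g i"
    and "\<And>f. sum f I = 0 \<Longrightarrow> (\<Sum>i\<in>I. \<Sum>j\<in>I. a i j * f i * f j) \<le> \<mu> * (\<Sum>i\<in>I. (f i)\<^sup>2)"
proof -
  define S where "S = {f :: 'v \<Rightarrow> real. (\<forall>i. i \<notin> I \<longrightarrow> f i = 0) \<and> (\<Sum>i\<in>I. (f i)\<^sup>2) = 1 \<and> sum f I = 0}"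
  define Q where "Q f = (\<Sum>i\<in>I. \<Sum>j\<in>I. a i j * f i * f j)" for f
  define N where "N f = (\<Sum>i\<in>I. (f i)\<^sup>2)" for f :: "'v \<Rightarrow> real"
  have normalize: "(\<lambda>i. if i \<in> I then f i / sqrt (N f) else 0) \<in> S"
    if "sum f I = 0" "N f \<noteq> 0" for f
  proof -
    have "N f > 0" using that(2) unfolding N_def by (metis less_eq_real_def sum_nonneg zero_le_power2)
    then have "(\<Sum>i\<in>I. (f i / sqrt (N f))\<^sup>2) = 1"
      by (simp add: power_divide flip: sum_divide_distrib) (simp add: N_def)
    moreover have "(\<Sum>i\<in>I. f i / sqrt (N f)) = 0"
      using that(1) by (simp flip: sum_divide_distrib)
    ultimately show ?thesis by (simp add: S_def)
  qed
  obtain x y where xy: "x \<in> I" "y \<in> I" "x \<noteq> y"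
    using card by (metis card_2_iff' obtain_subset_with_card_n subset_eq)
  \<comment> \<open>A nonzero mean-zero function, needed to know that the sphere is nonempty; this
    is where two indices are required.\<close>
  let ?f = "\<lambda>i. (if i = x then 1 else 0) - (if i = y then 1 else 0) :: real"
  have "sum ?f I = 0" using xy fin by (simp add: sum_subtractf)
  moreover have "N ?f \<noteq> 0"
  proof -
    have "(?f x)\<^sup>2 \<le> N ?f" unfolding N_def using xy fin by (intro member_le_sum) auto
    then show ?thesis using xy by simp
  qed
  ultimately have "S \<noteq> {}" using normalize by blast
  moreover have "compact S" unfolding S_def using fin by (rule compact_unit_sphere_fun)
  moreover have "continuous_on S Q"
    unfolding Q_def
    by (rule continuous_on_subset[of UNIV])
      (intro continuous_intros continuous_on_product_coordinates, simp)
  ultimately obtain g where g: "g \<in> S" and max: "\<And>f. f \<in> S \<Longrightarrow> Q f \<le> Q g"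
    using continuous_attains_sup by metis
  define \<mu> where "\<mu> = Q g"
  have Ng: "N g = 1" and sg: "sum g I = 0" using g by (auto simp: S_def N_def)
  have bound: "Q f \<le> \<mu> * N f" if f: "sum f I = 0" for f
  proof (cases "N f = 0")
    case True
    then have "\<forall>i\<in>I. f i = 0" using fin by (simp add: N_def sum_nonneg_eq_0_iff)
    then show ?thesis using True by (simp add: Q_def)
  next
    case False
    then have pos: "N f > 0" unfolding N_def by (metis less_eq_real_def sum_nonneg zero_le_power2)
    have "Q (\<lambda>i. if i \<in> I then f i / sqrt (N f) else 0) = (\<Sum>i\<in>I. \<Sum>j\<in>I. a i j * f i * f j / N f)"
      unfolding Q_def using pos by (intro sum.cong) auto
    also have "\<dots> = Q f / N f" by (simp add: Q_def sum_divide_distrib)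
    finally have "Q f / N f \<le> \<mu>" using max[OF normalize[OF f False]] by (simp add: \<mu>_def)
    then show ?thesis using pos by (simp add: field_simps)
  qed
  define M where "M f i = (\<Sum>j\<in>I. a i j * f j)" for f i
  have M_sym: "(\<Sum>i\<in>I. M f i * h i) = (\<Sum>i\<in>I. f i * M h i)" for f h
  proof -
    have "(\<Sum>i\<in>I. M f i * h i) = (\<Sum>i\<in>I. \<Sum>j\<in>I. a i j * f j * h i)"
      by (simp add: M_def sum_distrib_right)
    also have "\<dots> = (\<Sum>j\<in>I. \<Sum>i\<in>I. a i j * f j * h i)" by (rule sum.swap)
    also have "\<dots> = (\<Sum>j\<in>I. f j * M h j)"
      unfolding M_def sum_distrib_left by (intro sum.cong) (auto simp: sym)
    finally show ?thesis .
  qed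
  have Q_M: "Q f = (\<Sum>i\<in>I. f i * M f i)" for f
    unfolding Q_def M_def sum_distrib_left by (intro sum.cong) auto
  have M_add: "M (\<lambda>i. f i + t * h i) i = M f i + t * M h i" for f h t i
    by (simp add: M_def algebra_simps sum.distrib sum_distrib_left)
  \<comment> \<open>Along the line \<open>g + t * h\<close> the gap \<open>\<mu> * N - Q\<close> is
    a nonnegative quadratic in \<open>t\<close>. Its constant term is 0 because
    \<open>N g = 1\<close> and \<open>Q g = \<mu>\<close>, so its linear coefficient must
    vanish.\<close>
  have stationary: "(\<Sum>i\<in>I. (\<mu> * g i - M g i) * h i) = 0" if h: "sum h I = 0" for h
  proof (rule linear_coeff_zero)
    fix t
    let ?h = "\<lambda>i. g i + t * h i"
    have "sum ?h I = 0" using h sg by (simp add: sum.distrib flip: sum_distrib_left)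
    then have "0 \<le> \<mu> * N ?h - Q ?h" using bound by simp
    also have "N ?h = N g + 2 * t * (\<Sum>i\<in>I. g i * h i) + t\<^sup>2 * N h"
      by (simp add: N_def power2_eq_square algebra_simps sum.distrib sum_distrib_left)
    also have "Q ?h = Q g + t * (\<Sum>i\<in>I. g i * M h i) + t * (\<Sum>i\<in>I. M g i * h i) + t\<^sup>2 * Q h"
      unfolding Q_M M_add
      by (simp add: power2_eq_square algebra_simps sum.distrib sum_distrib_left)
    also have "(\<Sum>i\<in>I. g i * M h i) = (\<Sum>i\<in>I. M g i * h i)" by (simp add: M_sym)
    finally show "0 \<le> 2 * t * (\<Sum>i\<in>I. (\<mu> * g i - M g i) * h i) + t\<^sup>2 * (\<mu> * N h - Q h)"
      using Ng by (simp add: \<mu>_def algebra_simps sum.distrib sum_subtractf sum_distrib_left)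
  qed
  \<comment> \<open>The residual \<open>\<mu> * g - M g\<close> has mean zero, since
    \<open>M\<close> maps constants to constants. It is therefore an admissible direction, and
    stationarity tested on the residual itself says that its norm is 0.\<close>
  have "(\<Sum>i\<in>I. M g i) = (\<Sum>i\<in>I. g i * M (\<lambda>_. 1) i)" using M_sym[of g "\<lambda>_. 1"] by simp
  also have "\<dots> = d * sum g I" by (simp add: M_def row mult.commute sum_distrib_left)
  finally have "(\<Sum>i\<in>I. \<mu> * g i - M g i) = 0" using sg by (simp add: sum_subtractf flip: sum_distrib_left)
  from stationary[OF this] have "(\<Sum>i\<in>I. (\<mu> * g i - M g i)\<^sup>2) = 0" by (simp add: power2_eq_square)
  then have "\<And>i. i \<in> I \<Longrightarrow> M g i = \<mu> * g i" using fin by (simp add: sum_nonneg_eq_0_iff)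
  moreover have "\<exists>i\<in>I. g i \<noteq> 0" using Ng by (auto simp: N_def intro: ccontr)
  ultimately show thesis using that[of g \<mu>] sg bound by (simp add: M_def Q_def N_def)
qed

section \<open>Roots of the characteristic polynomial, counted with multiplicity\<close>

text \<open>Only the head of the decreasing list can exceed its second entry, so it cannot account
  for both \<open>a\<close> and \<open>b\<close>. The multiset inclusion counts multiplicity: for
  \<open>a = b\<close> it demands two occurrences.\<close>

lemma second_of_sorted:
  fixes M :: "real multiset"
  assumes "{#a, b#} \<subseteq># M"
  shows "min a b \<le> rev (sorted_list_of_multiset M) ! 1"
proof -
  define xs where "xs = rev (sorted_list_of_multiset M)"
  have "sorted (rev xs)" "mset xs = M" by (simp_all add: xs_def)
  moreover have "length xs \<ge> 2" using assms \<open>mset xs = M\<close> size_mset_mono by fastforce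
  ultimately obtain x y zs where xs: "xs = x # y # zs" by (metis One_nat_def Suc_1 Suc_le_length_iff)
  have le: "z \<le> y" if "z \<in> set (y # zs)" for z
    using \<open>sorted (rev xs)\<close> that by (auto simp: xs sorted_append)
  show ?thesis
  proof (rule ccontr)
    assume "\<not> ?thesis"
    then have "y < a" "y < b" by (auto simp: xs simp flip: xs_def)
    then have "a \<notin> set (y # zs)" "b \<notin> set (y # zs)" using le by force+
    moreover have "{#a, b#} \<subseteq># add_mset x (mset (y # zs))" using assms \<open>mset xs = M\<close> xs by simp
    ultimately have "a = x" "b \<in># mset (y # zs)"
      by (auto simp: insert_subset_eq_iff dest: mset_subset_eqD split: if_splits)
    then show False using \<open>b \<notin> set (y # zs)\<close> by (metis set_mset_mset)
  qed
qed

lemma poly_char_poly_eq_0I: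
  fixes A :: "'a :: field mat"
  assumes "A \<in> carrier_mat n n" and "i < n" and "g i \<noteq> 0"
    and "\<And>i. i < n \<Longrightarrow> (\<Sum>j<n. A $$ (i, j) * g j) = k * g i"
  shows "poly (char_poly A) k = 0"
proof -
  have "eigenvector A (vec n g) k"
    unfolding eigenvector_def
  proof (intro conjI)
    show "vec n g \<noteq> 0\<^sub>v (dim_row A)"
      using assms by (metis carrier_matD(1) index_vec index_zero_vec(1))
    show "A *\<^sub>v vec n g = k \<cdot>\<^sub>v vec n g"
      using assms by (intro eq_vecI) (auto simp: scalar_prod_def atLeast0LessThan)
  qed (use assms in auto)
  then have "eigenvalue A k" by (auto simp: eigenvalue_def)
  then show ?thesis using eigenvalue_root_char_poly assms by blast
qed

text \<open>Since \<open>h\<close> vanishes at \<open>i\<close>, the deleted column contributes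
  nothing to the eigenvalue equations. The restriction of \<open>h\<close> remains an eigenvector of
  the minor, nonzero because of the index \<open>k\<close>.\<close>

lemma poly_char_poly_mat_delete_eq_0:
  fixes A :: "'a :: field mat"
  assumes A: "A \<in> carrier_mat n n" and i: "i < n" and k: "k < n" and h: "h i = 0" "h k \<noteq> 0"
    and ev: "\<And>r. r < n \<Longrightarrow> (\<Sum>j<n. A $$ (r, j) * h j) = c * h r"
  shows "poly (char_poly (mat_delete A i i)) c = 0"
proof -
  obtain m where n: "n = Suc m" using i by (cases n) auto
  have image: "insert_index i ` {..<m} = {..<n} - {i}"
    using insert_index_image[of i m] i by (simp add: n atLeast0LessThan)
  then have "k \<in> insert_index i ` {..<m}" using k h by auto
  then obtain k' where k': "k' < m" "k = insert_index i k'" by auto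
  show ?thesis
  proof (rule poly_char_poly_eq_0I)
    show "mat_delete A i i \<in> carrier_mat m m" using mat_delete_carrier[OF A] by (simp add: n)
    show "k' < m" "h (insert_index i k') \<noteq> 0" using k' h by auto
    fix r assume r: "r < m"
    then have r': "insert_index i r < n" using image by blast
    have "(\<Sum>s<m. mat_delete A i i $$ (r, s) * h (insert_index i s))
        = (\<Sum>s<m. A $$ (insert_index i r, insert_index i s) * h (insert_index i s))"
      using mat_delete_index[of A m i i r] A i r by (intro sum.cong) (simp_all add: n)
    also have "\<dots> = (\<Sum>j\<in>{..<n} - {i}. A $$ (insert_index i r, j) * h j)"
      unfolding image[symmetric] by (simp add: sum.reindex insert_index_inj_on)
    also have "\<dots> = (\<Sum>j<n. A $$ (insert_index i r, j) * h j)"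
      using i h by (subst sum.remove[of _ i]) auto
    finally show "(\<Sum>s<m. mat_delete A i i $$ (r, s) * h (insert_index i s)) = c * h (insert_index i r)"
      using ev[OF r'] by simp
  qed
qed

text \<open>Links the variational eigenvalue \<open>\<mu>\<close> to a position in the sorted list
  of roots. In a disconnected regular graph \<open>\<mu>\<close> equals the degree, so that case has
  to be handled through the multiplicity of the root.\<close>

lemma second_largest_eigenvalue_ge_rayleigh:
  fixes adj :: "'v \<Rightarrow> 'v \<Rightarrow> bool" and f :: "'v \<Rightarrow> real"
  assumes dist: "distinct vs" and len: "length vs \<ge> 2"
    and sym: "\<And>x y. adj x y \<Longrightarrow> adj y x"
    and reg: "\<And>x. x \<in> set vs \<Longrightarrow> card {y \<in> set vs. adj x y} = d"
    and f: "sum f (set vs) = 0"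
  shows "(\<Sum>x\<in>set vs. \<Sum>y\<in>set vs. of_bool (adj x y) * f x * f y)
    \<le> second_largest_eigenvalue (adjacency_matrix vs adj) * (\<Sum>x\<in>set vs. (f x)\<^sup>2)"
proof -
  define a :: "'v \<Rightarrow> 'v \<Rightarrow> real" where "a x y = of_bool (adj x y)" for x y
  have a_sym: "a x y = a y x" for x y using sym by (auto simp: a_def)
  have a_nonneg: "a x y \<ge> 0" for x y by (simp add: a_def)
  define n where "n = length vs"
  define A where "A = adjacency_matrix vs adj"
  define p where "p = char_poly A"
  have A: "A \<in> carrier_mat n n" by (simp add: A_def adjacency_matrix_def n_def)
  have p0: "p \<noteq> 0" using degree_monic_char_poly[OF A] by (auto simp: p_def)
  have row: "(\<Sum>y\<in>set vs. a x y) = real d" if "x \<in> set vs" for x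
    using reg[OF that] by (simp add: a_def of_bool_def sum.If_cases Int_def conj_commute)
  obtain g \<mu> where g0: "\<exists>x\<in>set vs. g x \<noteq> 0" and gsum: "sum g (set vs) = 0"
    and ev: "\<And>x. x \<in> set vs \<Longrightarrow> (\<Sum>y\<in>set vs. a x y * g y) = \<mu> * g x"
    and bound: "\<And>f. sum f (set vs) = 0 \<Longrightarrow>
      (\<Sum>x\<in>set vs. \<Sum>y\<in>set vs. a x y * f x * f y) \<le> \<mu> * (\<Sum>x\<in>set vs. (f x)\<^sup>2)"
    by (rule rayleigh_quotient_attained[of "set vs" a "real d"])
      (use len row a_sym dist in \<open>auto simp: distinct_card\<close>)
  have A_mult: "(\<Sum>j<n. A $$ (i, j) * h (vs ! j)) = (\<Sum>y\<in>set vs. a (vs ! i) y * h y)"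
    if "i < n" for i and h :: "'v \<Rightarrow> real"
  proof -
    have "(\<Sum>j<n. A $$ (i, j) * h (vs ! j)) = (\<Sum>j<n. a (vs ! i) (vs ! j) * h (vs ! j))"
      using that by (intro sum.cong) (auto simp: A_def a_def adjacency_matrix_def n_def)
    also have "\<dots> = (\<Sum>y\<in>set vs. a (vs ! i) y * h y)"
      using bij_betw_nth[OF dist, of "{..<n}" "set vs"]
      by (intro sum.reindex_bij_betw) (simp add: n_def)
    finally show ?thesis .
  qed
  have root_d: "poly p d = 0"
    unfolding p_def
    by (rule poly_char_poly_eq_0I[OF A, where i = 0 and g = "\<lambda>i. (\<lambda>_. 1) (vs ! i)"])
      (use len row A_mult[of _ "\<lambda>_. 1"] in \<open>auto simp: n_def\<close>)
  obtain k where k: "k < n" "g (vs ! k) \<noteq> 0" using g0 by (auto simp: in_set_conv_nth n_def)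
  have root_\<mu>: "poly p \<mu> = 0"
    unfolding p_def
    by (rule poly_char_poly_eq_0I[OF A, where i = k and g = "\<lambda>i. g (vs ! i)"])
      (use k ev A_mult[of _ g] in \<open>auto simp: n_def\<close>)
  \<comment> \<open>Ensures that \<open>\<mu>\<close> is the smaller of the two roots. In the
    quadratic form each product \<open>g x * g y\<close> is bounded by the average of the squares;
    symmetry and the row sums \<open>d\<close> then give \<open>d * ?N\<close>.\<close>
  have "\<mu> \<le> d"
  proof -
    let ?N = "\<Sum>x\<in>set vs. (g x)\<^sup>2"
    have "?N \<noteq> 0" using g0 by (auto simp: sum_nonneg_eq_0_iff)
    then have N: "?N > 0" by (metis less_eq_real_def sum_nonneg zero_le_power2)
    have "\<mu> * ?N = (\<Sum>x\<in>set vs. g x * (\<Sum>y\<in>set vs. a x y * g y))"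
      unfolding sum_distrib_left by (intro sum.cong) (simp_all add: ev power2_eq_square flip: sum_distrib_left)
    also have "\<dots> = (\<Sum>x\<in>set vs. \<Sum>y\<in>set vs. a x y * (g x * g y))"
      by (simp add: sum_distrib_left algebra_simps)
    also have "\<dots> \<le> (\<Sum>x\<in>set vs. \<Sum>y\<in>set vs. a x y * (((g x)\<^sup>2 + (g y)\<^sup>2) / 2))"
    proof (intro sum_mono mult_left_mono)
      fix x y
      show "g x * g y \<le> ((g x)\<^sup>2 + (g y)\<^sup>2) / 2"
        using sum_squares_bound[of "g x" "g y"] by simp
    qed (rule a_nonneg)
    also have "\<dots> = (\<Sum>x\<in>set vs. \<Sum>y\<in>set vs. a x y * (g x)\<^sup>2 / 2)
        + (\<Sum>x\<in>set vs. \<Sum>y\<in>set vs. a x y * (g y)\<^sup>2 / 2)"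
      by (simp add: sum.distrib[symmetric] algebra_simps add_divide_distrib)
    also have "(\<Sum>x\<in>set vs. \<Sum>y\<in>set vs. a x y * (g y)\<^sup>2 / 2)
        = (\<Sum>x\<in>set vs. \<Sum>y\<in>set vs. a x y * (g x)\<^sup>2 / 2)"
      by (subst sum.swap) (simp add: a_sym)
    also have "(\<Sum>x\<in>set vs. \<Sum>y\<in>set vs. a x y * (g x)\<^sup>2 / 2) = d * ?N / 2"
      by (simp add: row sum_distrib_left flip: sum_divide_distrib sum_distrib_right)
    finally show ?thesis using N by simp
  qed
  have "{#real d, \<mu>#} \<subseteq># proots p"
  proof (cases "\<mu> = d")
    case False
    then show ?thesis using p0 root_d root_\<mu> order_root[of p \<mu>] by (simp add: insert_subset_eq_iff in_diff_count)
  next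
    case True
    \<comment> \<open>Constants and \<open>g\<close> share the eigenvalue \<open>d\<close>, so
      subtracting the constant \<open>g (vs ! i)\<close> yields another eigenvector that vanishes at
      \<open>i\<close>. It is nonzero, as a constant mean-zero \<open>g\<close> would be 0.\<close>
    have "poly (char_poly (mat_delete A i i)) d = 0" if i: "i < n" for i
    proof -
      define h where "h = (\<lambda>x. g x - g (vs ! i))"
      have "\<exists>k<n. h (vs ! k) \<noteq> 0"
      proof (rule ccontr)
        assume "\<not> ?thesis"
        then have const: "g x = g (vs ! i)" if "x \<in> set vs" for x
          using that by (auto simp: h_def in_set_conv_nth n_def)
        then have "sum g (set vs) = n * g (vs ! i)" by (simp add: n_def distinct_card dist)
        then have "g (vs ! i) = 0" using gsum i by simp
        then show False using g0 const by simp
      qed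
      then obtain k where k: "k < n" "h (vs ! k) \<noteq> 0" by blast
      show ?thesis
      proof (rule poly_char_poly_mat_delete_eq_0[OF A i k(1), where h = "\<lambda>j. h (vs ! j)"])
        fix r assume r: "r < n"
        then have r': "vs ! r \<in> set vs" by (simp add: n_def)
        have "(\<Sum>j<n. A $$ (r, j) * h (vs ! j))
            = (\<Sum>y\<in>set vs. a (vs ! r) y * h y)"
          by (rule A_mult[OF r])
        also have "\<dots> = (\<Sum>y\<in>set vs. a (vs ! r) y * g y) - (\<Sum>y\<in>set vs. a (vs ! r) y) * g (vs ! i)"
          by (simp add: h_def algebra_simps sum_subtractf sum_distrib_left)
        also have "\<dots> = d * h (vs ! r)"
          unfolding ev[OF r'] row[OF r'] by (simp add: True h_def algebra_simps)
        finally show "(\<Sum>j<n. A $$ (r, j) * h (vs ! j)) = d * h (vs ! r)" .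
      qed (use k in \<open>auto simp: h_def\<close>)
    qed
    \<comment> \<open>The derivative of a characteristic polynomial is the sum of those of the
      principal minors of size \<open>n - 1\<close>. A common root of \<open>p\<close> and its
      nonzero derivative has order at least 2.\<close>
    then have "poly (pderiv p) d = 0" by (simp add: p_def pderiv_char_poly[OF A] poly_sum)
    moreover have "pderiv p \<noteq> 0"
      using degree_monic_char_poly[OF A] len by (auto simp: p_def n_def pderiv_eq_0_iff)
    ultimately have "order d p \<ge> 2"
      using order_pderiv[OF p0 root_d] order_root[of "pderiv p" d] by auto
    then show ?thesis using p0 True by (simp add: subseteq_mset_def)
  qed
  from second_of_sorted[OF this] have "\<mu> \<le> second_largest_eigenvalue A"
    using \<open>\<mu> \<le> d\<close> by (simp add: second_largest_eigenvalue_def real_eigenvalues_def p_def min_absorb2)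
  then have "\<mu> * (\<Sum>x\<in>set vs. (f x)\<^sup>2) \<le> second_largest_eigenvalue A * (\<Sum>x\<in>set vs. (f x)\<^sup>2)"
    by (intro mult_right_mono sum_nonneg) auto
  then show ?thesis using bound[OF f] by (simp add: A_def a_def)
qed

lemma card_filter_eq_sum:
  "finite S \<Longrightarrow> card {x \<in> S. P x} = (\<Sum>x\<in>S. of_bool (P x))"
  by (simp only: card_eq_sum sum.inter_filter of_bool_def)

text \<open>The difference of two vertex indicators has squared norm 2, and its quadratic form is -2
  or 0 according to whether the vertices are adjacent. The Rayleigh quotient is thus at least
  -1.\<close>

lemma second_largest_eigenvalue_ge_minus_1:
  fixes adj :: "'v \<Rightarrow> 'v \<Rightarrow> bool"
  assumes dist: "distinct vs" and len: "length vs \<ge> 2"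
    and sym: "\<And>x y. adj x y \<Longrightarrow> adj y x" and irrefl: "\<And>x. \<not> adj x x"
    and reg: "\<And>x. x \<in> set vs \<Longrightarrow> card {y \<in> set vs. adj x y} = d"
  shows "-1 \<le> second_largest_eigenvalue (adjacency_matrix vs adj)"
proof -
  obtain u v us where "vs = u # v # us"
    using len by (metis One_nat_def Suc_1 Suc_le_length_iff)
  then have uv: "u \<in> set vs" "v \<in> set vs" "u \<noteq> v" using dist by auto
  \<comment> \<open>Summation against this \<open>f\<close> evaluates a difference at
    \<open>u\<close> and \<open>v\<close>; \<open>sum_f\<close> is applied first to the inner and
    then to the outer sum of the quadratic form.\<close>
  define f :: "'v \<Rightarrow> real" where "f x = of_bool (x = u) - of_bool (x = v)" for x
  have sum_f: "(\<Sum>x\<in>set vs. h x * f x) = h u - h v" for h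
  proof -
    have "(\<Sum>x\<in>set vs. h x * f x) = (\<Sum>x\<in>{u, v}. h x * f x)"
      using uv by (intro sum.mono_neutral_right) (auto simp: f_def)
    then show ?thesis using uv(3) by (simp add: f_def)
  qed
  have "(\<Sum>x\<in>set vs. \<Sum>y\<in>set vs. of_bool (adj x y) * f x * f y)
      = (\<Sum>x\<in>set vs. of_bool (adj x u) * f x - of_bool (adj x v) * f x)"
    by (intro sum.cong refl sum_f)
  also have "\<dots> = (\<Sum>x\<in>set vs. (of_bool (adj x u) - of_bool (adj x v)) * f x)"
    by (simp only: left_diff_distrib)
  also have "\<dots> = (of_bool (adj u u) - of_bool (adj u v)) - (of_bool (adj v u) - of_bool (adj v v))"
    by (rule sum_f)
  also have "\<dots> = - 2 * of_bool (adj u v)"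
    using irrefl sym by (auto simp: of_bool_def)
  finally have Q: "(\<Sum>x\<in>set vs. \<Sum>y\<in>set vs. of_bool (adj x y) * f x * f y) = - 2 * of_bool (adj u v)" .
  have norm: "(\<Sum>x\<in>set vs. (f x)\<^sup>2) = 2"
    unfolding power2_eq_square sum_f using uv by (simp add: f_def)
  have "sum f (set vs) = 0" using sum_f[of "\<lambda>_. 1"] by simp
  from second_largest_eigenvalue_ge_rayleigh[where adj = adj, OF dist len sym reg this]
  have "- 2 * of_bool (adj u v) \<le> second_largest_eigenvalue (adjacency_matrix vs adj) * 2"
    unfolding Q norm .
  moreover have "of_bool (adj u v) \<le> (1::real)" by simp
  ultimately show ?thesis by linarith
qed

text \<open>Turns an upper bound on the quadratic form into a lower bound on the energy. The double
  sum runs over ordered pairs, so every edge of the graph is counted twice.\<close>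

lemma dirichlet_energy_regular:
  fixes g :: "'v \<Rightarrow> real"
  assumes fin: "finite S" and sym: "\<And>x y. adj x y \<Longrightarrow> adj y x"
    and reg: "\<And>x. x \<in> S \<Longrightarrow> card {y \<in> S. adj x y} = d"
  shows "(\<Sum>x\<in>S. \<Sum>y\<in>S. of_bool (adj x y) * (g x - g y)\<^sup>2)
    = 2 * real d * (\<Sum>x\<in>S. (g x)\<^sup>2) - 2 * (\<Sum>x\<in>S. \<Sum>y\<in>S. of_bool (adj x y) * g x * g y)"
proof -
  define a :: "'v \<Rightarrow> 'v \<Rightarrow> real" where "a x y = of_bool (adj x y)" for x y
  have a_sym: "a x y = a y x" for x y using sym by (auto simp: a_def)
  have row: "(\<Sum>y\<in>S. a x y) = real d" if "x \<in> S" for x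
  proof -
    have "(\<Sum>y\<in>S. a x y) = real (card {y \<in> S. adj x y})"
      unfolding card_filter_eq_sum[OF fin] a_def by simp
    then show ?thesis using reg[OF that] by simp
  qed
  have diag: "(\<Sum>x\<in>S. \<Sum>y\<in>S. a x y * (g x)\<^sup>2) = d * (\<Sum>x\<in>S. (g x)\<^sup>2)"
    by (simp add: row sum_distrib_left flip: sum_distrib_right)
  have "(\<Sum>x\<in>S. \<Sum>y\<in>S. a x y * (g x - g y)\<^sup>2)
      = (\<Sum>x\<in>S. \<Sum>y\<in>S. a x y * (g x)\<^sup>2) + (\<Sum>x\<in>S. \<Sum>y\<in>S. a x y * (g y)\<^sup>2)
        - 2 * (\<Sum>x\<in>S. \<Sum>y\<in>S. a x y * g x * g y)"
    by (simp add: power2_diff algebra_simps sum.distrib sum_subtractf sum_distrib_left)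
  also have "(\<Sum>x\<in>S. \<Sum>y\<in>S. a x y * (g y)\<^sup>2) = (\<Sum>x\<in>S. \<Sum>y\<in>S. a x y * (g x)\<^sup>2)"
    by (subst sum.swap) (simp add: a_sym)
  finally show ?thesis unfolding diag by (simp add: a_def)
qed

lemma sum_power2_centered:
  fixes f :: "'v \<Rightarrow> real"
  assumes "finite S" and "S \<noteq> {}"
  defines "m \<equiv> sum f S / card S"
  shows "(\<Sum>x\<in>S. f x - m) = 0"
    and "(\<Sum>x\<in>S. (f x - m)\<^sup>2) = (\<Sum>x\<in>S. (f x)\<^sup>2) - (sum f S)\<^sup>2 / card S"
proof -
  have c: "real (card S) \<noteq> 0" using assms by simp
  then show "(\<Sum>x\<in>S. f x - m) = 0" by (simp add: sum_subtractf m_def)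
  have "(\<Sum>x\<in>S. (f x - m)\<^sup>2) = (\<Sum>x\<in>S. (f x)\<^sup>2) - 2 * m * sum f S + card S * m\<^sup>2"
    by (simp add: power2_diff sum.distrib sum_subtractf flip: sum_distrib_left sum_distrib_right)
  also have "\<dots> = (\<Sum>x\<in>S. (f x)\<^sup>2) - (sum f S)\<^sup>2 / card S"
    using c by (simp add: m_def field_simps power2_eq_square)
  finally show "(\<Sum>x\<in>S. (f x - m)\<^sup>2) = (\<Sum>x\<in>S. (f x)\<^sup>2) - (sum f S)\<^sup>2 / card S" .
qed

section \<open>Triangles and cuts\<close>

lemma triangle_edges:
  assumes "simplicial_complex X" and "{x, y, z} \<in> X" and "x \<noteq> y" "x \<noteq> z" "y \<noteq> z"
  shows "{e \<in> faces 1 X. e \<subseteq> {x, y, z}} = {{x, y}, {x, z}, {y, z}}"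
proof (intro equalityI subsetI)
  fix e assume "e \<in> {{x, y}, {x, z}, {y, z}}"
  then have "e \<subseteq> {x, y, z}" "e \<noteq> {}" "card e = 2" using assms(3-5) by auto
  moreover from this have "e \<in> X" using assms(1,2) unfolding simplicial_complex_def by blast
  ultimately show "e \<in> {e \<in> faces 1 X. e \<subseteq> {x, y, z}}" by (simp add: faces_def)
next
  fix e assume e: "e \<in> {e \<in> faces 1 X. e \<subseteq> {x, y, z}}"
  then have "card e = 2" by (simp add: faces_def)
  then obtain u v where uv: "e = {u, v}" "u \<noteq> v" by (auto simp: card_2_iff)
  then have "u = x \<or> u = y \<or> u = z" "v = x \<or> v = y \<or> v = z" using e by auto
  then have "e = {x, y} \<or> e = {x, z} \<or> e = {y, z}"
    unfolding uv(1) doubleton_eq_iff using uv(2) by blast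
  then show "e \<in> {{x, y}, {x, z}, {y, z}}" by simp
qed

text \<open>Two distinct edges already span at least three vertices, so their union fills any
  triangle containing both. Adjacent vertices of the embedded graph thus have a unique witnessing
  triangle.\<close>

lemma triangle_eqI:
  fixes T :: "'a set"
  assumes "card T = 3" "card T' = 3" "card e = 2" "card e' = 2" "e \<noteq> e'"
    and "e \<union> e' \<subseteq> T" "e \<union> e' \<subseteq> T'"
  shows "T = T'"
proof -
  have fin: "finite T" "finite T'" "finite e" "finite e'" using assms by (auto intro: card_ge_0_finite)
  have "\<not> e' \<subseteq> e" using assms(3-5) fin card_subset_eq by metis
  then have "card e < card (e \<union> e')" using fin by (intro psubset_card_mono) auto
  then have "card (e \<union> e') \<ge> 3" using assms by simp
  then have "e \<union> e' = S" if "card S = 3" "e \<union> e' \<subseteq> S" for S :: "'a set"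
    using that by (intro card_seteq) (auto intro: card_ge_0_finite)
  then have "e \<union> e' = T" "e \<union> e' = T'" using assms by blast+
  then show ?thesis by simp
qed

text \<open>Groups the neighbours of \<open>e\<close> by the triangle they share with
  \<open>e\<close>. Uniqueness of that triangle makes the groups disjoint, so no neighbour is
  counted twice.\<close>

lemma sum_embedded_adj:
  fixes \<phi> :: "'a set \<Rightarrow> real"
  assumes fin: "finite X" and e: "e \<in> faces 1 X"
  shows "(\<Sum>e'\<in>faces 1 X. of_bool (embedded_adj 2 X e e') * \<phi> e')
    = (\<Sum>T | T \<in> faces 2 X \<and> e \<subseteq> T. \<Sum>e'\<in>{e' \<in> faces 1 X. e' \<subseteq> T} - {e}. \<phi> e')"
proof -
  have fin': "finite (faces k X)" for k using fin by (simp add: faces_def)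
  have eq: "{e' \<in> faces 1 X. embedded_adj 2 X e e'}
      = (\<Union>T\<in>{T \<in> faces 2 X. e \<subseteq> T}. {e' \<in> faces 1 X. e' \<subseteq> T} - {e})"
    using e by (auto simp: embedded_adj_def)
  have "(\<Sum>e'\<in>faces 1 X. of_bool (embedded_adj 2 X e e') * \<phi> e')
      = sum \<phi> {e' \<in> faces 1 X. embedded_adj 2 X e e'}"
    unfolding sum.inter_filter[OF fin'] by (intro sum.cong) auto
  also have "\<dots> = (\<Sum>T | T \<in> faces 2 X \<and> e \<subseteq> T. \<Sum>e'\<in>{e' \<in> faces 1 X. e' \<subseteq> T} - {e}. \<phi> e')"
    unfolding eq
  proof (rule sum.UNION_disjoint)
    show "\<forall>T\<in>{T \<in> faces 2 X. e \<subseteq> T}. \<forall>T'\<in>{T \<in> faces 2 X. e \<subseteq> T}. T \<noteq> T' \<longrightarrow>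
      ({e' \<in> faces 1 X. e' \<subseteq> T} - {e}) \<inter> ({e' \<in> faces 1 X. e' \<subseteq> T'} - {e}) = {}"
    proof (intro ballI impI equals0I)
      fix T T' e'
      assume T: "T \<in> {T \<in> faces 2 X. e \<subseteq> T}" "T' \<in> {T \<in> faces 2 X. e \<subseteq> T}" "T \<noteq> T'"
        and e': "e' \<in> ({e' \<in> faces 1 X. e' \<subseteq> T} - {e}) \<inter> ({e' \<in> faces 1 X. e' \<subseteq> T'} - {e})"
      have "T = T'"
        by (rule triangle_eqI[of T T' e e']) (use T e e' in \<open>auto simp: faces_def\<close>)
      with T show False by simp
    qed
  qed (use fin' in auto)
  finally show ?thesis .
qed

text \<open>Each of the \<open>D\<close> triangles on \<open>e\<close> contributes its two other
  edges; this is \<open>sum_embedded_adj\<close> with constant weight 1.\<close>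

lemma card_embedded_adj:
  assumes sc: "simplicial_complex X" and fin: "finite X" and e: "e \<in> faces 1 X"
    and D: "card {F \<in> faces 2 X. e \<subseteq> F} = D"
  shows "card {e' \<in> faces 1 X. embedded_adj 2 X e e'} = 2 * D"
proof -
  have two: "card ({e' \<in> faces 1 X. e' \<subseteq> T} - {e}) = 2" if T: "T \<in> faces 2 X" "e \<subseteq> T" for T
  proof -
    obtain x y z where xyz: "T = {x, y, z}" "x \<noteq> y" "x \<noteq> z" "y \<noteq> z"
      using T by (auto simp: faces_def card_3_iff numeral_3_eq_3[symmetric])
    have "{x, y, z} \<in> X" using T xyz by (simp add: faces_def)
    note edges = triangle_edges[OF sc this xyz(2-4)]
    have "card {{x, y}, {x, z}, {y, z}} = 3" using xyz(2-4) by (auto simp: doubleton_eq_iff)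
    moreover have "e \<in> {{x, y}, {x, z}, {y, z}}" using T e edges xyz(1) by blast
    ultimately show ?thesis unfolding xyz(1) edges by (subst card_Diff_singleton) auto
  qed
  have fin': "finite (faces k X)" for k using fin by (simp add: faces_def)
  have "real (card {e' \<in> faces 1 X. embedded_adj 2 X e e'})
      = (\<Sum>e'\<in>faces 1 X. of_bool (embedded_adj 2 X e e') * 1)"
    unfolding card_filter_eq_sum[OF fin'] by simp
  also have "\<dots> = (\<Sum>T | T \<in> faces 2 X \<and> e \<subseteq> T. 2)"
    unfolding sum_embedded_adj[OF fin e] using two by (intro sum.cong) auto
  also have "\<dots> = real (2 * D)" by (simp add: D)
  finally show ?thesis using of_nat_eq_iff by blast
qed

section \<open>Double counting over cut triangles and vertex degrees\<close>

lemma cut_faces_iff: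
  assumes "F \<in> faces n X"
  shows "F \<in> cut_faces n X A (verts X - A) \<longleftrightarrow> \<not> F \<subseteq> A \<and> F \<inter> A \<noteq> {}"
  using assms by (auto simp: cut_faces_def faces_def verts_def)

text \<open>A cut triangle separates one vertex from the other two. The two edges at that vertex
  have value 1 and the opposite edge has value 0 or 2, so the squared differences add up to 2, or 4
  over ordered pairs. On an uncut triangle \<open>f\<close> is constant.\<close>

lemma cut_energy:
  fixes A :: "'a set"
  assumes sc: "simplicial_complex X" and fin: "finite X"
  defines "f \<equiv> \<lambda>e. real (card (e \<inter> A))"
  shows "(\<Sum>e\<in>faces 1 X. \<Sum>e'\<in>faces 1 X. of_bool (embedded_adj 2 X e e') * (f e - f e')\<^sup>2)
    = 4 * card (cut_faces 2 X A (verts X - A))"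
proof -
  have fin': "finite (faces k X)" for k using fin by (simp add: faces_def)
  let ?E = "\<lambda>T. {e \<in> faces 1 X. e \<subseteq> T}"
  have inner: "(\<Sum>e\<in>?E T. \<Sum>e'\<in>?E T - {e}. (f e - f e')\<^sup>2)
      = 4 * of_bool (T \<in> cut_faces 2 X A (verts X - A))" if T: "T \<in> faces 2 X" for T
  proof -
    obtain x y z where xyz: "T = {x, y, z}" "x \<noteq> y" "x \<noteq> z" "y \<noteq> z"
      using T by (auto simp: faces_def card_3_iff numeral_3_eq_3[symmetric])
    have X: "{x, y, z} \<in> X" using T xyz by (simp add: faces_def)
    note edges = triangle_edges[OF sc this xyz(2-4)]
    have neq: "{x, y} \<noteq> {x, z}" "{x, y} \<noteq> {y, z}" "{x, z} \<noteq> {y, z}"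
      using xyz(2-4) by (auto simp: doubleton_eq_iff)
    \<comment> \<open>The diagonal terms restored here are 0; a full double sum over the three edges
      is easier to expand.\<close>
    have "(\<Sum>e\<in>?E T. \<Sum>e'\<in>?E T - {e}. (f e - f e')\<^sup>2) = (\<Sum>e\<in>?E T. \<Sum>e'\<in>?E T. (f e - f e')\<^sup>2)"
      using fin' by (intro sum.cong sum.mono_neutral_left) auto
    also have "\<dots> = 2 * ((f {x, y} - f {x, z})\<^sup>2 + (f {x, y} - f {y, z})\<^sup>2 + (f {x, z} - f {y, z})\<^sup>2)"
      unfolding xyz(1) edges using neq by (simp add: power2_commute)
    also have "\<dots> = 4 * of_bool (\<not> (x \<in> A \<and> y \<in> A \<and> z \<in> A) \<and> (x \<in> A \<or> y \<in> A \<or> z \<in> A))"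
      using xyz(2-4) by (simp add: f_def Int_insert_left card_insert_if)
    finally show ?thesis unfolding cut_faces_iff[OF T] unfolding xyz(1) by simp
  qed
  have "(\<Sum>e\<in>faces 1 X. \<Sum>e'\<in>faces 1 X. of_bool (embedded_adj 2 X e e') * (f e - f e')\<^sup>2)
      = (\<Sum>e\<in>faces 1 X. \<Sum>T\<in>{T \<in> faces 2 X. e \<subseteq> T}. \<Sum>e'\<in>?E T - {e}. (f e - f e')\<^sup>2)"
    by (intro sum.cong refl sum_embedded_adj[OF fin])
  also have "\<dots> = (\<Sum>T\<in>faces 2 X. \<Sum>e\<in>?E T. \<Sum>e'\<in>?E T - {e}. (f e - f e')\<^sup>2)"
    by (rule sum.swap_restrict[OF fin' fin'])
  also have "\<dots> = (\<Sum>T\<in>faces 2 X. 4 * of_bool (T \<in> cut_faces 2 X A (verts X - A)))"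
    using inner by (intro sum.cong) auto
  also have "\<dots> = 4 * card (faces 2 X \<inter> cut_faces 2 X A (verts X - A))"
    using fin' by (simp flip: sum_distrib_left)
  also have "faces 2 X \<inter> cut_faces 2 X A (verts X - A) = cut_faces 2 X A (verts X - A)"
    by (auto simp: cut_faces_def)
  finally show ?thesis .
qed

text \<open>Counts incident pairs of a cut edge and a triangle: a cut edge lies in \<open>D\<close>
  triangles, a cut triangle has exactly two cut edges, and an uncut triangle has none.\<close>

lemma card_cut_edges:
  assumes sc: "simplicial_complex X" and fin: "finite X"
    and D: "\<forall>e\<in>faces 1 X. card {F \<in> faces 2 X. e \<subseteq> F} = D"
  shows "D * card {e \<in> faces 1 X. card (e \<inter> A) = 1} = 2 * card (cut_faces 2 X A (verts X - A))"
proof -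
  have fin': "finite (faces k X)" for k using fin by (simp add: faces_def)
  let ?W = "{e \<in> faces 1 X. card (e \<inter> A) = 1}"
  have inner: "card {e \<in> ?W. e \<subseteq> T} = 2 * of_bool (T \<in> cut_faces 2 X A (verts X - A))"
    if T: "T \<in> faces 2 X" for T
  proof -
    obtain x y z where xyz: "T = {x, y, z}" "x \<noteq> y" "x \<noteq> z" "y \<noteq> z"
      using T by (auto simp: faces_def card_3_iff numeral_3_eq_3[symmetric])
    have X: "{x, y, z} \<in> X" using T xyz by (simp add: faces_def)
    have "{e \<in> ?W. e \<subseteq> T} = {e \<in> {e \<in> faces 1 X. e \<subseteq> {x, y, z}}. card (e \<inter> A) = 1}"
      by (auto simp: xyz(1))
    also have "\<dots> = {e \<in> {{x, y}, {x, z}, {y, z}}. card (e \<inter> A) = 1}"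
      unfolding triangle_edges[OF sc X xyz(2-4)] ..
    finally have "card {e \<in> ?W. e \<subseteq> T} = (\<Sum>e\<in>{{x, y}, {x, z}, {y, z}}. of_bool (card (e \<inter> A) = 1))"
      by (simp only: card_filter_eq_sum finite.intros)
    also have "\<dots> = 2 * of_bool (\<not> (x \<in> A \<and> y \<in> A \<and> z \<in> A) \<and> (x \<in> A \<or> y \<in> A \<or> z \<in> A))"
      using xyz(2-4) by (simp add: Int_insert_left card_insert_if doubleton_eq_iff)
    finally show ?thesis unfolding cut_faces_iff[OF T] unfolding xyz(1) by simp
  qed
  have "D * card ?W = (\<Sum>e\<in>?W. \<Sum>T\<in>{T \<in> faces 2 X. e \<subseteq> T}. 1)" using D by simp
  also have "\<dots> = (\<Sum>T\<in>faces 2 X. \<Sum>e\<in>{e \<in> ?W. e \<subseteq> T}. 1)"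
    using fin' by (intro sum.swap_restrict) auto
  also have "\<dots> = (\<Sum>T\<in>faces 2 X. 2 * of_bool (T \<in> cut_faces 2 X A (verts X - A)))"
    using inner by (intro sum.cong) auto
  also have "\<dots> = 2 * card (faces 2 X \<inter> cut_faces 2 X A (verts X - A))"
    using fin' by (simp flip: sum_distrib_left)
  also have "faces 2 X \<inter> cut_faces 2 X A (verts X - A) = cut_faces 2 X A (verts X - A)"
    by (auto simp: cut_faces_def)
  finally show ?thesis .
qed

text \<open>Counts incidences between \<open>A\<close> and the edges in two ways; it identifies the
  total of the test function with a degree sum.\<close>

lemma sum_card_edges_Int:
  assumes fin: "finite X" and A: "finite A"
  shows "(\<Sum>e\<in>faces 1 X. card (e \<inter> A)) = (\<Sum>v\<in>A. vertex_degree X v)"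
proof -
  have fin': "finite (faces k X)" for k using fin by (simp add: faces_def)
  have "(\<Sum>e\<in>faces 1 X. card (e \<inter> A)) = (\<Sum>e\<in>faces 1 X. \<Sum>v\<in>{v \<in> A. v \<in> e}. 1)"
    by (intro sum.cong) (auto intro: arg_cong[of _ _ card])
  also have "\<dots> = (\<Sum>v\<in>A. \<Sum>e\<in>{e \<in> faces 1 X. v \<in> e}. 1)"
    by (rule sum.swap_restrict[OF fin' A])
  finally show ?thesis by (simp add: vertex_degree_def)
qed

lemma vertex_in_triangle:
  assumes fin: "finite X" and pure: "pure_complex 2 X" and v: "v \<in> verts X"
  obtains T where "T \<in> faces 2 X" "v \<in> T"
proof -
  obtain F where F: "F \<in> X" "v \<in> F" using v by (auto simp: verts_def)
  then obtain T where T: "T \<in> X" "F \<subseteq> T" "\<forall>G\<in>X. T \<subseteq> G \<longrightarrow> T = G"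
    using finite_has_maximal2[OF fin, of F] by auto
  then have "T \<in> faces 2 X" using pure by (auto simp: pure_complex_def)
  then show thesis using that T F by blast
qed

text \<open>By purity \<open>v\<close> lies in a triangle, two of whose edges contain
  \<open>v\<close>. The bound later lets one factor of the minimum degree be traded for the constant
  2.\<close>

lemma vertex_degree_ge_2:
  assumes sc: "simplicial_complex X" and fin: "finite X" and pure: "pure_complex 2 X"
    and v: "v \<in> verts X"
  shows "vertex_degree X v \<ge> 2"
proof -
  obtain T where T: "T \<in> faces 2 X" "v \<in> T" using vertex_in_triangle[OF fin pure v] .
  obtain x y z where xyz: "T = {x, y, z}" "x \<noteq> y" "x \<noteq> z" "y \<noteq> z"
    using T by (auto simp: faces_def card_3_iff numeral_3_eq_3[symmetric])
  have X: "{x, y, z} \<in> X" using T xyz by (simp add: faces_def)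
  have "{e \<in> {{x, y}, {x, z}, {y, z}}. v \<in> e} \<subseteq> {e \<in> faces 1 X. v \<in> e}"
    using triangle_edges[OF sc X xyz(2-4)] by blast
  moreover have "card {e \<in> {{x, y}, {x, z}, {y, z}}. v \<in> e}
      = (\<Sum>e\<in>{{x, y}, {x, z}, {y, z}}. of_bool (v \<in> e))"
    by (intro card_filter_eq_sum) simp
  moreover have "\<dots> = 2" using T xyz by (auto simp: doubleton_eq_iff)
  moreover have "finite {e \<in> faces 1 X. v \<in> e}" using fin by (simp add: faces_def)
  ultimately show ?thesis unfolding vertex_degree_def by (metis (no_types, lifting) card_mono)
qed

section \<open>From the spectral gap to the bound on H(X)\<close>

text \<open>Here \<open>C\<close> and \<open>E\<close> stand for the numbers of cut triangles and
  cut edges, \<open>S\<close> and \<open>T\<close> for the degree sums of the two sides,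
  \<open>a\<close> and \<open>b\<close> for their sizes, and \<open>w\<close> for the number of
  edges.\<close>

lemma cut_bound_arith:
  fixes C D E w lam S T \<delta> a b :: real
  assumes D: "D \<ge> 1" and E: "D * E = 2 * C" and E0: "E \<ge> 0" and w: "w > 0"
    and lam: "-1 \<le> lam"
    and gap: "(2 * D - lam) * (S * T / w - E) \<le> 2 * C"
    and S: "\<delta> * a \<le> S" and T: "\<delta> * b \<le> T" and \<delta>: "\<delta> \<ge> 2" and a: "a \<ge> 0" and b: "b \<ge> 0"
  shows "\<delta> * (2 * D - lam) * (a * b) / (4 * w) \<le> C"
proof -
  have C: "C \<ge> 0" using E mult_nonneg_nonneg[of D E] D E0 by simp
  show ?thesis
  \<comment> \<open>Splitting on the sign avoids proving an upper bound on \<open>lam\<close>: when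
    the factor is negative, the left side is nonpositive while \<open>C\<close> is not
    negative.\<close>
  proof (cases "2 * D - lam \<ge> 0")
    case False
    then have "\<delta> * (2 * D - lam) * (a * b) \<le> 0"
      using \<delta> a b by (simp add: mult_nonneg_nonpos mult_nonpos_nonneg)
    then have "\<delta> * (2 * D - lam) * (a * b) / (4 * w) \<le> 0"
      using w by (simp add: divide_le_0_iff)
    then show ?thesis using C by simp
  next
    case True
    \<comment> \<open>From \<open>lam \<ge> -1\<close> and \<open>D \<ge> 1\<close> comes
      \<open>2 * D - lam \<le> 3 * D\<close>, and \<open>3 * D * E = 6 * C\<close>. Together with
      the \<open>2 * C\<close> of \<open>gap\<close> this makes \<open>8 * C\<close>; against the 2
      in \<open>2 * \<delta> * (a * b)\<close> it leaves the final denominator 4.\<close>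
    have "(2 * D - lam) * E \<le> (3 * D) * E" using D lam E0 by (intro mult_right_mono) auto
    then have "(2 * D - lam) * (S * T / w) \<le> 8 * C" using gap E by (simp add: algebra_simps)
    moreover have "2 * \<delta> * (a * b) \<le> \<delta> * \<delta> * (a * b)"
      using \<delta> a b by (intro mult_right_mono) auto
    moreover have "\<delta> * a * (\<delta> * b) \<le> S * T" using S T \<delta> a b by (intro mult_mono) (auto intro: order_trans[OF _ S])
    ultimately have "2 * \<delta> * (a * b) \<le> S * T" by (simp add: algebra_simps)
    then have "(2 * D - lam) * (2 * \<delta> * (a * b) / w) \<le> (2 * D - lam) * (S * T / w)"
      using True w by (intro mult_left_mono divide_right_mono) auto
    also have "\<dots> \<le> 8 * C" by fact
    finally show ?thesis using w by (simp add: field_simps)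
  qed
qed

lemma face_finite_nonempty:
  assumes "simplicial_complex X" and "F \<in> X"
  shows "finite F" and "F \<noteq> {}"
  using assms unfolding simplicial_complex_def by blast+

text \<open>The estimate for a single vertex set, with the denominator of the Cheeger quotient moved
  to the other side so that no division by the sizes of \<open>A\<close> and its complement
  occurs.\<close>

lemma cut_faces_bound:
  fixes X :: "'a set set" and D :: nat
  assumes sc: "simplicial_complex X" and fin: "finite X" and pure: "pure_complex 2 X"
    and "D > 0" and D: "\<forall>e\<in>faces 1 X. card {F \<in> faces 2 X. e \<subseteq> F} = D"
    and ws: "distinct ws" "set ws = faces 1 X" and "faces 2 X \<noteq> {}"
    and A: "A \<subseteq> verts X"
  defines "lam \<equiv> second_largest_eigenvalue (adjacency_matrix ws (embedded_adj 2 X))"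
  shows "real (min_degree X) * (2 * real D - lam) * (real (card A) * real (card (verts X - A)))
      / (4 * real (card (faces 1 X))) \<le> real (card (cut_faces 2 X A (verts X - A)))"
proof -
  define W where "W = faces 1 X"
  define B where "B = verts X - A"
  define C where "C = card (cut_faces 2 X A B)"
  define E where "E = card {e \<in> W. card (e \<inter> A) = 1}"
  define f where "f e = real (card (e \<inter> A))" for e
  define S where "S P = (\<Sum>v\<in>P. vertex_degree X v)" for P
  have finW: "finite W" using fin by (simp add: W_def faces_def)
  have finV: "finite (verts X)" unfolding verts_def using fin face_finite_nonempty[OF sc] by blast
  then have finAB: "finite A" "finite B" using A finite_subset by (auto simp: B_def)
  have sub: "e \<subseteq> verts X" "finite e" "card e = 2" if "e \<in> W" for e
    using that face_finite_nonempty[OF sc] by (auto simp: W_def faces_def verts_def)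
  obtain T where T: "T \<in> faces 2 X" using \<open>faces 2 X \<noteq> {}\<close> by blast
  \<comment> \<open>The second largest eigenvalue is the list entry at index 1, so at least two
    edges must exist; any triangle supplies them.\<close>
  have len: "length ws \<ge> 2"
  proof -
    obtain x y z where xyz: "T = {x, y, z}" "x \<noteq> y" "x \<noteq> z" "y \<noteq> z"
      using T by (auto simp: faces_def card_3_iff numeral_3_eq_3[symmetric])
    have "{x, y, z} \<in> X" using T xyz by (simp add: faces_def)
    from triangle_edges[OF sc this xyz(2-4)] have "{{x, y}, {x, z}} \<subseteq> W"
      unfolding W_def by blast
    then have "card {{x, y}, {x, z}} \<le> card W" by (intro card_mono finW)
    moreover have "{x, y} \<noteq> {x, z}" using xyz by (simp add: doubleton_eq_iff)
    ultimately show ?thesis using ws by (simp add: W_def flip: distinct_card)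
  qed
  have w: "card W > 0" using len ws by (simp add: W_def flip: distinct_card)
  have adj_sym: "embedded_adj 2 X e' e" if "embedded_adj 2 X e e'" for e e'
    using that by (auto simp: embedded_adj_def)
  have reg: "card {e' \<in> W. embedded_adj 2 X e e'} = 2 * D" if "e \<in> W" for e
    using card_embedded_adj[OF sc fin] D that by (simp add: W_def)
  have setW: "set ws = W" using ws by (simp add: W_def)
  have lam: "-1 \<le> lam"
    unfolding lam_def
    by (rule second_largest_eigenvalue_ge_minus_1[OF ws(1) len adj_sym])
      (use reg in \<open>auto simp: setW embedded_adj_def\<close>)
  define m where "m = sum f W / card W"
  have "W \<noteq> {}" using w by auto
  note centered = sum_power2_centered[OF finW this, of f, folded m_def]
  have "4 * real C = (\<Sum>e\<in>W. \<Sum>e'\<in>W. of_bool (embedded_adj 2 X e e') * (f e - f e')\<^sup>2)"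
    using cut_energy[OF sc fin, of A] by (simp only: W_def C_def B_def f_def)
  \<comment> \<open>Centring leaves all differences unchanged, hence also the energy, while making
    the function admissible for the Rayleigh bound.\<close>
  also have "\<dots> = (\<Sum>e\<in>W. \<Sum>e'\<in>W. of_bool (embedded_adj 2 X e e') * ((f e - m) - (f e' - m))\<^sup>2)"
    by simp
  also have "\<dots> = 2 * real (2 * D) * (\<Sum>e\<in>W. (f e - m)\<^sup>2)
      - 2 * (\<Sum>e\<in>W. \<Sum>e'\<in>W. of_bool (embedded_adj 2 X e e') * (f e - m) * (f e' - m))"
    by (rule dirichlet_energy_regular[OF finW adj_sym reg])
  also have "\<dots> \<ge> 2 * real (2 * D) * (\<Sum>e\<in>W. (f e - m)\<^sup>2) - 2 * (lam * (\<Sum>e\<in>W. (f e - m)\<^sup>2))"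
    using second_largest_eigenvalue_ge_rayleigh[OF ws(1) len adj_sym, where d = "2 * D" and f = "\<lambda>e. f e - m"]
    by (simp add: setW reg centered(1) lam_def)
  finally have energy: "(2 * D - lam) * (\<Sum>e\<in>W. (f e - m)\<^sup>2) \<le> 2 * C"
    by (simp add: algebra_simps)
  have sum_f: "sum f W = S A"
    using sum_card_edges_Int[OF fin finAB(1)] by (simp add: f_def W_def S_def flip: of_nat_sum)
  have "S A + S B = (\<Sum>e\<in>W. card (e \<inter> A) + card (e \<inter> B))"
    using sum_card_edges_Int[OF fin finAB(1)] sum_card_edges_Int[OF fin finAB(2)]
    by (simp add: W_def S_def sum.distrib)
  also have "\<dots> = (\<Sum>e\<in>W. 2)"
  proof (rule sum.cong[OF refl])
    fix e assume e: "e \<in> W"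
    have "card (e \<inter> A) + card (e \<inter> B) = card ((e \<inter> A) \<union> (e \<inter> B))"
      using finAB by (intro card_Un_disjoint[symmetric]) (auto simp: B_def)
    also have "(e \<inter> A) \<union> (e \<inter> B) = e" using sub(1)[OF e] by (auto simp: B_def)
    finally show "card (e \<inter> A) + card (e \<inter> B) = 2" using sub(3)[OF e] by simp
  qed
  finally have S_sum: "S A + S B = 2 * card W" by simp
  \<comment> \<open>For \<open>k\<close> in {0, 1, 2} the square of \<open>k\<close> is
    \<open>2 * k\<close>, except that it is one less at \<open>k = 1\<close>. That correction is
    what brings the number of cut edges into the variance.\<close>
  have "(f e)\<^sup>2 = 2 * f e - of_bool (card (e \<inter> A) = 1)" if e: "e \<in> W" for e
  proof -
    have "card (e \<inter> A) \<le> 2" using sub[OF e] by (metis card_mono inf_le1)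
    then have "card (e \<inter> A) = 0 \<or> card (e \<inter> A) = 1 \<or> card (e \<inter> A) = 2" by linarith
    then show ?thesis unfolding f_def by (elim disjE) simp_all
  qed
  then have "(\<Sum>e\<in>W. (f e)\<^sup>2) = 2 * S A - real E"
    by (simp add: sum_subtractf sum_f E_def card_filter_eq_sum[OF finW] flip: sum_distrib_left)
  then have "(\<Sum>e\<in>W. (f e - m)\<^sup>2) = 2 * real (S A) - real E - (real (S A))\<^sup>2 / card W"
    by (simp add: centered(2) sum_f)
  also have "\<dots> = real (S A) * real (S B) / card W - real E"
  proof -
    \<comment> \<open>Writing \<open>2 * card W\<close> as \<open>S A + S B\<close> splits off
      \<open>(S A)^2 / card W\<close>, which cancels the squared mean and leaves the product of the
      two degree sums.\<close>
    have "2 * real (S A) = real (S A) * (2 * real (card W)) / card W" using w by simp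
    also have "2 * real (card W) = real (S A) + real (S B)" using S_sum by linarith
    finally show ?thesis by (simp add: power2_eq_square distrib_left add_divide_distrib)
  qed
  finally have gap: "(2 * real D - lam) * (real (S A) * real (S B) / card W - real E) \<le> 2 * real C"
    using energy by simp
  have "D * E = 2 * C"
    using card_cut_edges[OF sc fin D, of A] by (simp add: E_def C_def W_def B_def)
  then have DE: "real D * real E = 2 * real C" by (metis of_nat_mult of_nat_numeral)
  have degree: "real (min_degree X) * real (card P) \<le> real (S P)" if "P \<subseteq> verts X" for P
  proof -
    have "min_degree X \<le> vertex_degree X v" if "v \<in> P" for v
      unfolding min_degree_def using that \<open>P \<subseteq> verts X\<close> finV by (intro Min_le) auto
    then have "card P * min_degree X \<le> S P"
      using sum_bounded_below[of P "min_degree X" "vertex_degree X"] by (simp add: S_def)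
    then show ?thesis by (metis mult.commute of_nat_le_iff of_nat_mult)
  qed
  have "T \<noteq> {}" using T by (auto simp: faces_def)
  then have "verts X \<noteq> {}" using T by (auto simp: verts_def faces_def)
  then have "min_degree X \<ge> 2"
    unfolding min_degree_def using finV vertex_degree_ge_2[OF sc fin pure] by simp
  then show ?thesis
    using cut_bound_arith[OF _ DE _ _ lam gap degree degree] A w \<open>D > 0\<close>
    by (simp add: W_def B_def C_def)
qed

theorem theorem1p2:
  fixes X :: "'a set set" and D :: nat and V :: "'a set"
    and W :: "'a set set" and ws :: "'a set list" and lam :: real
  assumes "simplicial_complex X" and "finite X"
    and "connected_complex X" and "pure_complex 2 X"
    and "D > 0"
    and "\<forall>e\<in>faces 1 X. card {F \<in> faces 2 X. e \<subseteq> F} = D"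
    and "V = verts X" and "W = faces 1 X"
    and "distinct ws" and "set ws = W"
    and "lam = second_largest_eigenvalue (adjacency_matrix ws (embedded_adj 2 X))"
  shows "real (card V) * real (min_degree X) * (2 * real D - lam) / (4 * real (card W))
           \<le> cheeger 2 X"
proof -
  let ?H = "\<lambda>A. real (card V) * real (card (cut_faces 2 X A (V - A)))
                 / (real (card A) * real (card (V - A)))"
  have finV: "finite V" unfolding assms(7) verts_def using assms(2) face_finite_nonempty[OF assms(1)] by blast
  obtain F where "F \<in> X" using assms(4) by (auto simp: pure_complex_def)
  then obtain v where "v \<in> verts X" using face_finite_nonempty(2)[OF assms(1)] unfolding verts_def by blast
  then obtain T where T: "T \<in> faces 2 X" "v \<in> T"
    using vertex_in_triangle[OF assms(2,4)] by blast
  have "T \<subseteq> V" "card T = 3" using T assms(7) by (auto simp: faces_def verts_def)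
  then have cardV: "card V \<ge> 3" using card_mono[OF finV] by metis
  have bound: "real (card V) * real (min_degree X) * (2 * real D - lam) / (4 * real (card W)) \<le> ?H A"
    if A: "A \<subseteq> V" "0 < card A" "card A < card V" for A
  proof -
    have pos: "real (card A) * real (card (V - A)) > 0"
      using A finV by (simp add: card_Diff_subset finite_subset)
    have "real (min_degree X) * (2 * real D - lam) * (real (card A) * real (card (V - A)))
        / (4 * real (card W)) \<le> real (card (cut_faces 2 X A (V - A)))"
      using cut_faces_bound[OF assms(1,2,4-6,9), of A] A T assms(7,8,10,11) by auto
    \<comment> \<open>Properness of \<open>A\<close> makes both sizes positive, so dividing by them
      and then multiplying by the number of vertices recovers the Cheeger quotient.\<close>
    then have "real (min_degree X) * (2 * real D - lam) / (4 * real (card W))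
        \<le> real (card (cut_faces 2 X A (V - A))) / (real (card A) * real (card (V - A)))"
      unfolding pos_le_divide_eq[OF pos] by simp
    from mult_left_mono[OF this, of "real (card V)"] show ?thesis by simp
  qed
  \<comment> \<open>A single vertex is a proper subset, as a triangle forces at least three
    vertices. The minimum is thus taken over a nonempty set and can be bounded elementwise.\<close>
  have "{v} \<in> {A. A \<subseteq> V \<and> 0 < card A \<and> card A < card V}"
    using \<open>v \<in> verts X\<close> cardV assms(7) by simp
  then have "{A. A \<subseteq> V \<and> 0 < card A \<and> card A < card V} \<noteq> {}" by blast
  moreover have "finite {A. A \<subseteq> V \<and> 0 < card A \<and> card A < card V}" using finV by simp
  ultimately show ?thesis
    unfolding cheeger_def Let_def assms(7)[symmetric]
    by (subst Min_ge_iff) (use bound in auto)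
qed

end
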